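(* Let $p>0$. (i) For real $m>-1$ with $m>-\frac1p$, $V_m^p(0)$ is defined (the defining integral at $x=0$ is finite) and $V_m^p(0)=\dfrac{\Gamma(m+\frac1p)}{\Gamma(m+1)}$. (ii) For all real $m\ge 0$ and all $x>0$, $V_m^p$ satisfies the differential equation $$\frac{d}{dx}V_m^p(x)=p\,x^{p-1}\left(V_m^p(x)-V_{m-1}^p(x)\right).$$ (iii) For all real $m>-1$, as a function of $x>0$, $V_m^p$ is decreasing if $p>1$, identically equal to $1$ if $p=1$, and increasing if $p<1$. (iv) Let $m>-1$ and $x>0$. For $a>0$, the expression $a^{p-1}V_m^p(ax)$ increases in $a$ if $p>1$ and decreases in $a$ if $p<1$.
   Context: For real $p>0$, real $m>-1$ and $x>0$, $V_m^p(x)=\frac{p e^{x^p}}{\Gamma(m+1)}\int_x^\infty (t^p-x^p)^m e^{-t^p}\,dt=\frac{1}{\Gamma(m+1)}\int_0^\infty \frac{u^m e^{-u}}{(x^p+u)^{(p-1)/p}}\,du$; the second formula also defines $V_m^p(0)$ whenever the integral at $x=0$ converges. By convention $V_{-1}^p(x)=x^{1-p}$ for $x>0$. *)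

theory Defs
  imports "HOL-Analysis.Analysis"
begin

text \<open>
  The integrand is the one obtained from the tail integral over \<open>t > x\<close> by substituting
  \<open>u = t powr p - x powr p\<close>; the two formulas are shown to agree for \<open>x > 0\<close> in
  \<open>V_eq_tail_integral\<close> below.  Since \<open>0 powr p = 0\<close>, it is also the correct integrand at \<open>x = 0\<close>.
\<close>

definition V_integrand :: "real \<Rightarrow> real \<Rightarrow> real \<Rightarrow> real \<Rightarrow> real" where
  "V_integrand p m x u = u powr m * exp (- u) / (x powr p + u) powr ((p - 1) / p)"

definition V :: "real \<Rightarrow> real \<Rightarrow> real \<Rightarrow> real" where
  "V p m x =
     (if m = -1 then x powr (1 - p)
      else (LBINT u:{0<..}. V_integrand p m x u) / Gamma (m + 1))"

lemma V_integrand_measurable [measurable]: "V_integrand p m x \<in> borel_measurable borel"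
  unfolding V_integrand_def by measurable

lemma V_integrand_integrable:
  assumes "p > 0" "m > -1" "x > 0"
  shows "set_integrable lborel {0<..} (V_integrand p m x)"
proof -
  define q where "q = (1 - p) / p"
  have G: "set_integrable lborel {0<..} (\<lambda>u. u powr s * exp (- u))" if "s > -1" for s :: real
  proof -
    have "(\<lambda>u. u powr s / exp u) absolutely_integrable_on {0..}"
      using Gamma_integral_real[of "s+1"] that
      by (intro nonnegative_absolutely_integrable_1) (auto simp: integrable_on_def)
    then have "(\<lambda>u. u powr s / exp u) absolutely_integrable_on {0<..}"
      by (rule set_integrable_subset) auto
    then show ?thesis
      unfolding set_integrable_def
      by (subst (asm) integrable_completion) (auto simp: exp_minus field_simps)
  qed
  let ?b = "\<lambda>u. (x powr p) powr q * (u powr m * exp (-u))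
             + 2 powr \<bar>q\<bar> * ((x powr p) powr q * (u powr m * exp (-u)) + u powr (m + \<bar>q\<bar>) * exp (-u))"
  have "set_integrable lborel {0<..} ?b"
    using G assms by (intro set_integral_add set_integrable_mult_right) auto
  then show ?thesis
  proof (rule set_integrable_bound)
    show "set_borel_measurable lborel {0<..} (V_integrand p m x)"
      unfolding set_borel_measurable_def by simp
    show "AE u in lborel. u \<in> {0<..} \<longrightarrow> norm (V_integrand p m x u) \<le> norm (?b u)"
    proof (rule AE_I2, rule impI)
      fix u :: real assume "u \<in> {0<..}"
      then have u: "u > 0" by simp
      define X where "X = x powr p"
      have X: "X > 0" using assms by (simp add: X_def)
      have key: "(X + u) powr q \<le> X powr q + 2 powr \<bar>q\<bar> * (X powr q + u powr \<bar>q\<bar>)"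
      proof (cases "q \<ge> 0")
        case True
        have "(X + u) powr q \<le> (2 * max X u) powr q"
          using X u True by (intro powr_mono2) auto
        also have "\<dots> = 2 powr q * max X u powr q" using X u by (simp add: powr_mult)
        also have "\<dots> \<le> 2 powr q * (X powr q + u powr q)"
          by (intro mult_left_mono) (auto simp: max_def)
        also have "\<dots> \<le> X powr q + 2 powr q * (X powr q + u powr q)" by simp
        finally show ?thesis using True by simp
      next
        case False
        have "(X + u) powr q \<le> X powr q"
          using X u False by (intro powr_mono2') auto
        then show ?thesis by (smt (verit) mult_nonneg_nonneg powr_ge_zero)
      qed
      have "V_integrand p m x u = (u powr m * exp (-u)) * (X + u) powr q"
        unfolding V_integrand_def X_def q_def
        by (simp add: powr_minus[symmetric] divide_inverse minus_divide_left[symmetric]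
              flip: powr_minus minus_mult_left) (simp add: algebra_simps)
      moreover have "\<dots> \<le> (u powr m * exp (-u)) * (X powr q + 2 powr \<bar>q\<bar> * (X powr q + u powr \<bar>q\<bar>))"
        by (intro mult_left_mono key) auto
      moreover have "\<dots> = ?b u"
        unfolding X_def powr_add by (simp add: algebra_simps)
      moreover have "V_integrand p m x u \<ge> 0" by (simp add: V_integrand_def)
      ultimately show "norm (V_integrand p m x u) \<le> norm (?b u)" by auto
    qed
  qed
qed

lemma V_eq_tail_integral:
  assumes "p > 0" "m > -1" "x > 0"
  shows "set_integrable lborel {x<..} (\<lambda>t. (t powr p - x powr p) powr m * exp (- (t powr p)))"
    and "V p m x = p * exp (x powr p) / Gamma (m + 1) *
           (LBINT t:{x<..}. (t powr p - x powr p) powr m * exp (- (t powr p)))"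
proof -
  let ?h = "\<lambda>t. (t powr p - x powr p) powr m * exp (- (t powr p))"
  let ?S = "{x<..}"
  define g where "g = (\<lambda>t. t powr p - x powr p)"
  define g' where "g' = (\<lambda>t. p * t powr (p - 1))"
  have der: "(g has_field_derivative g' t) (at t within ?S)" if "t \<in> ?S" for t
    using that assms unfolding g_def g'_def by (auto intro!: derivative_eq_intros)
  have inj: "inj_on g ?S"
  proof (rule inj_onI)
    fix s t assume "s \<in> ?S" "t \<in> ?S" "g s = g t"
    then show "s = t" using assms powr_inj[of p] unfolding g_def
      by (metis add_diff_cancel diff_add_cancel greaterThan_iff less_trans less_irrefl linorder_neqE powr_less_mono2 order.strict_implies_order)
  qed
  have img: "g ` ?S = {0<..}"
  proof (intro equalityI subsetI)
    fix u assume "u \<in> g ` ?S"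
    then show "u \<in> {0<..}" using assms by (auto simp: g_def intro!: powr_less_mono2)
  next
    fix u :: real assume "u \<in> {0<..}"
    then have u: "u > 0" by simp
    define t where "t = (x powr p + u) powr (1/p)"
    have "t powr p = x powr p + u" using assms u by (simp add: t_def powr_powr add_pos_pos)
    moreover have "t > x"
    proof -
      have "(x powr p) powr (1/p) < t" unfolding t_def using assms u by (intro powr_less_mono2) auto
      then show ?thesis using assms by (simp add: powr_powr)
    qed
    ultimately show "u \<in> g ` ?S" by (intro image_eqI[of _ _ t]) (auto simp: g_def)
  qed
  have eq: "\<bar>g' t\<bar> * V_integrand p m x (g t) = p * exp (x powr p) * ?h t" if "t \<in> ?S" for t
  proof -
    have t: "t > 0" using that assms by simp
    have "(x powr p + g t) powr ((p - 1) / p) = t powr (p - 1)"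
      using assms t by (simp add: g_def powr_powr)
    moreover have "exp (- g t) = exp (x powr p) * exp (- (t powr p))"
      by (simp add: g_def flip: exp_add)
    ultimately show ?thesis
      using assms t by (simp add: V_integrand_def g'_def g_def)
  qed
  have I: "V_integrand p m x absolutely_integrable_on {0<..}"
    using V_integrand_integrable[OF assms] unfolding set_integrable_def
    by (subst integrable_completion) auto
  have cv: "(\<lambda>t. \<bar>g' t\<bar> * V_integrand p m x (g t)) absolutely_integrable_on ?S \<and>
       integral ?S (\<lambda>t. \<bar>g' t\<bar> * V_integrand p m x (g t)) = integral {0<..} (V_integrand p m x)"
    using has_absolute_integral_change_of_variables_1'[OF _ der inj,
        of "V_integrand p m x" "integral {0<..} (V_integrand p m x)"] I
    unfolding img by simp
  have c: "(\<lambda>t. p * exp (x powr p) * ?h t) absolutely_integrable_on ?S"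
    using cv eq set_integrable_cong[of lebesgue lebesgue ?S ?S] by (metis (no_types, lifting))
  then have "(\<lambda>t. (1 / (p * exp (x powr p))) * (p * exp (x powr p) * ?h t)) absolutely_integrable_on ?S"
    by (rule set_integrable_mult_right)
  then have "?h absolutely_integrable_on ?S" using assms by simp
  then show tail: "set_integrable lborel ?S ?h"
    unfolding set_integrable_def by (subst (asm) integrable_completion) auto
  have "integral {0<..} (V_integrand p m x) = integral ?S (\<lambda>t. p * exp (x powr p) * ?h t)"
    using cv eq by (metis (no_types, lifting) integral_cong)
  then show "V p m x = p * exp (x powr p) / Gamma (m + 1) * (LBINT t:?S. ?h t)"
    using assms set_borel_integral_eq_integral(2)[OF tail]
      set_borel_integral_eq_integral(2)[OF V_integrand_integrable[OF assms]]
    by (simp add: V_def)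
qed

end

theory Submission
  imports Defs "HOL-Real_Asymp.Real_Asymp"
begin

text \<open>
  Everything is read off from one integral. With \<open>q = 1 / p - 1\<close> and \<open>X = x powr p\<close>, the function
  \<open>V p m x\<close> is, up to the factor \<open>Gamma (m + 1)\<close>, the integral over \<open>u > 0\<close> of
  \<open>u powr m * exp (- u) * (X + u) powr q\<close>, and \<open>q\<close> is negative, zero or positive according as
  \<open>p > 1\<close>, \<open>p = 1\<close> or \<open>p < 1\<close>.

  The value at \<open>0\<close> and the case \<open>p = 1\<close> are Euler's integral for \<open>Gamma\<close>. The monotonicity
  claims hold already for the integrand at each fixed \<open>u\<close>: \<open>(X + u) powr q\<close> is monotone in \<open>X\<close>, and
  the factor \<open>a powr (p - 1)\<close> turns \<open>((a * x) powr p + u) powr q\<close> into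
  \<open>(x powr p + u / a powr p) powr q\<close>, whose base decreases in \<open>a\<close>, so that the direction is
  reversed (\<open>scaled_shifted_kernel\<close>). A pointwise strict inequality on the half-line integrates to
  a strict one (\<open>half_line_integral_strict_mono\<close>).

  For the differential equation, differentiating in \<open>X\<close> under the integral sign puts the
  derivative on \<open>(X + u) powr q\<close> (\<open>shifted_gamma_has_derivative\<close>). There a derivative in \<open>X\<close> is the
  same as a derivative in \<open>u\<close>, so integration by parts moves it onto \<open>u powr m * exp (- u)\<close>
  (\<open>shifted_gamma_by_parts\<close>). This yields the terms for \<open>m\<close> and \<open>m - 1\<close>, the latter with
  a factor \<open>m\<close> that \<open>Gamma (m + 1) = m * Gamma m\<close> absorbs. For \<open>m = 0\<close> that term vanishes, but the boundary
  at \<open>u = 0\<close> contributes \<open>X powr q = x powr (1 - p)\<close>, which is the conventional \<open>V p (- 1) x\<close>.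
\<close>

section \<open>Integrals over general measures and over the half-line\<close>

text \<open>
  Differentiation under the integral sign: by the mean value theorem the bound on the derivative
  dominates all difference quotients, so dominated convergence applies along every sequence that
  tends to the point.
\<close>

lemma has_real_derivative_lebesgue_integral:
  fixes f f' :: "real \<Rightarrow> 'a \<Rightarrow> real"
  assumes S: "open S" "convex S" "x \<in> S"
    and f: "\<And>y. y \<in> S \<Longrightarrow> integrable M (f y)"
    and f': "f' x \<in> borel_measurable M"
    and deriv: "\<And>y u. y \<in> S \<Longrightarrow> u \<in> space M \<Longrightarrow> ((\<lambda>y. f y u) has_real_derivative f' y u) (at y)"
    and bound: "\<And>y u. y \<in> S \<Longrightarrow> u \<in> space M \<Longrightarrow> \<bar>f' y u\<bar> \<le> w u"
    and w: "integrable M w"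
  shows "((\<lambda>y. \<integral>u. f y u \<partial>M) has_real_derivative (\<integral>u. f' x u \<partial>M)) (at x)"
proof -
  have quotient_bound: "\<bar>(f y u - f x u) / (y - x)\<bar> \<le> w u"
    if "y \<in> S" "y \<noteq> x" "u \<in> space M" for y u
  proof -
    have "norm (f y u - f x u) \<le> w u * norm (y - x)"
    proof (rule field_differentiable_bound[OF S(2)])
      show "((\<lambda>y. f y u) has_field_derivative f' z u) (at z within S)" if "z \<in> S" for z
        using deriv[OF that \<open>u \<in> space M\<close>] by (rule has_field_derivative_at_within)
      show "norm (f' z u) \<le> w u" if "z \<in> S" for z
        using bound[OF that \<open>u \<in> space M\<close>] by simp
    qed (use S that in auto)
    then show ?thesis
      using that by (simp add: divide_simps)
  qed
  have "((\<lambda>y. ((\<integral>u. f y u \<partial>M) - (\<integral>u. f x u \<partial>M)) / (y - x)) \<longlongrightarrow> (\<integral>u. f' x u \<partial>M)) (at x within S)"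
    unfolding tendsto_at_iff_sequentially o_def
  proof (intro allI impI)
    fix Y :: "nat \<Rightarrow> real"
    assume Y: "\<forall>i. Y i \<in> S - {x}" "Y \<longlonglongrightarrow> x"
    have "(\<lambda>i. \<integral>u. (f (Y i) u - f x u) / (Y i - x) \<partial>M) \<longlonglongrightarrow> (\<integral>u. f' x u \<partial>M)"
    proof (rule integral_dominated_convergence[OF f' _ w])
      show "(\<lambda>u. (f (Y i) u - f x u) / (Y i - x)) \<in> borel_measurable M" for i
        using f[of "Y i"] f[of x] Y S by (auto intro!: borel_measurable_divide borel_measurable_diff)
      show "AE u in M. (\<lambda>i. (f (Y i) u - f x u) / (Y i - x)) \<longlonglongrightarrow> f' x u"
      proof (rule AE_I2)
        fix u assume "u \<in> space M"
        then have "((\<lambda>y. (f y u - f x u) / (y - x)) \<longlongrightarrow> f' x u) (at x)"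
          using deriv[OF S(3)] by (simp add: has_field_derivative_iff)
        then show "(\<lambda>i. (f (Y i) u - f x u) / (Y i - x)) \<longlonglongrightarrow> f' x u"
          using Y unfolding tendsto_at_iff_sequentially o_def by simp
      qed
      show "AE u in M. norm ((f (Y i) u - f x u) / (Y i - x)) \<le> w u" for i
        using quotient_bound Y by (intro AE_I2) auto
    qed
    also have "(\<lambda>i. \<integral>u. (f (Y i) u - f x u) / (Y i - x) \<partial>M)
             = (\<lambda>i. ((\<integral>u. f (Y i) u \<partial>M) - (\<integral>u. f x u \<partial>M)) / (Y i - x))"
      using f Y S by auto
    finally show "(\<lambda>i. ((\<integral>u. f (Y i) u \<partial>M) - (\<integral>u. f x u \<partial>M)) / (Y i - x)) \<longlonglongrightarrow> (\<integral>u. f' x u \<partial>M)" .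
  qed
  then show ?thesis
    unfolding has_field_derivative_iff at_within_open[OF S(3,1)] .
qed

text \<open>
  If the integrals agreed, the nonnegative function \<open>g - f\<close> would vanish almost everywhere on the
  half-line, although it is positive on the interval \<open>{0<..<1}\<close>, which has positive measure.
\<close>

lemma half_line_integral_strict_mono:
  fixes f g :: "real \<Rightarrow> real"
  assumes f: "set_integrable lborel {0<..} f" and g: "set_integrable lborel {0<..} g"
    and less: "\<And>u. u > 0 \<Longrightarrow> f u < g u"
  shows "(LBINT u:{0<..}. f u) < (LBINT u:{0<..}. g u)"
proof -
  let ?d = "\<lambda>u. indicator {0<..} u * (g u - f u)"
  have d: "set_integrable lborel {0<..} (\<lambda>u. g u - f u)"
    using g f by (rule set_integral_diff)
  have d_nonneg: "?d u \<ge> 0" for u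
    using less[of u] by (auto simp: indicator_def)
  have "(\<integral>u. ?d u \<partial>lborel) \<noteq> 0"
  proof
    assume "(\<integral>u. ?d u \<partial>lborel) = 0"
    then have "AE u in lborel. ?d u = 0"
      using d d_nonneg by (subst (asm) integral_nonneg_eq_0_iff_AE) (auto simp: set_integrable_def)
    then have "AE u in lborel. u \<notin> {0<..<1::real}"
      by (rule AE_mp) (use less in \<open>force simp: indicator_def intro!: AE_I2\<close>)
    then have "emeasure lborel {0<..<1::real} = 0"
      by (subst (asm) AE_iff_measurable[of "{0<..<1}"]) auto
    then show False by simp
  qed
  moreover have "(\<integral>u. ?d u \<partial>lborel) \<ge> 0"
    using d_nonneg by (intro integral_nonneg_AE) auto
  moreover have "(\<integral>u. ?d u \<partial>lborel) = (LBINT u:{0<..}. g u) - (LBINT u:{0<..}. f u)"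
    using set_integral_diff(2)[OF g f] by (simp add: set_lebesgue_integral_def)
  ultimately show ?thesis by simp
qed

lemma Gamma_half_line_integral:
  fixes s :: real
  assumes "s > -1"
  shows "set_integrable lborel {0<..} (\<lambda>u. u powr s * exp (- u))"
    and "(LBINT u:{0<..}. u powr s * exp (- u)) = Gamma (s + 1)"
proof -
  have HI: "((\<lambda>u. u powr s / exp u) has_integral Gamma (s + 1)) {0..}"
    using Gamma_integral_real[of "s + 1"] assms by simp
  then have "(\<lambda>u. u powr s / exp u) absolutely_integrable_on {0..}"
    by (intro nonnegative_absolutely_integrable_1) (auto simp: integrable_on_def)
  then have "(\<lambda>u. u powr s / exp u) absolutely_integrable_on {0<..}"
    by (rule set_integrable_subset) auto
  then show int: "set_integrable lborel {0<..} (\<lambda>u. u powr s * exp (- u))"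
    unfolding set_integrable_def
    by (subst (asm) integrable_completion) (auto simp: exp_minus field_simps)
  have "negligible {u \<in> {0..} - {0<..}. u powr s * exp (- u) \<noteq> 0}"
    and "negligible {u \<in> {0<..} - {0..}. u powr s * exp (- u) \<noteq> 0}"
    by (rule negligible_subset[of "{0}"]; auto)+
  from has_integral_spike_set_eq[OF this]
  have "((\<lambda>u. u powr s * exp (- u)) has_integral Gamma (s + 1)) {0<..}"
    using HI by (simp add: exp_minus field_simps)
  then show "(LBINT u:{0<..}. u powr s * exp (- u)) = Gamma (s + 1)"
    using set_borel_integral_eq_integral(2)[OF int] by (simp add: integral_unique)
qed

section \<open>The gamma integral with a shifted power\<close>

definition shifted_kernel :: "real \<Rightarrow> real \<Rightarrow> real \<Rightarrow> real \<Rightarrow> real" where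
  "shifted_kernel q m X u = u powr m * exp (- u) * (X + u) powr q"

text \<open>
  In terms of Tricomi's confluent hypergeometric function \<open>U\<close>, this is
  \<open>Gamma (m + 1) * X powr (m + q + 1) * U (m + 1) (m + q + 2) X\<close> for \<open>m > -1\<close> and \<open>X > 0\<close>.
\<close>

definition shifted_gamma :: "real \<Rightarrow> real \<Rightarrow> real \<Rightarrow> real" where
  "shifted_gamma q m X = (LBINT u:{0<..}. shifted_kernel q m X u)"

lemma shifted_kernel_measurable [measurable]: "shifted_kernel q m X \<in> borel_measurable borel"
  unfolding shifted_kernel_def by measurable

lemma V_integrand_eq_shifted_kernel:
  assumes "p > 0"
  shows "V_integrand p m x u = shifted_kernel (1 / p - 1) m (x powr p) u"
proof -
  have "1 / p - 1 = - ((p - 1) / p)" using assms by (simp add: field_simps)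
  then show ?thesis
    unfolding V_integrand_def shifted_kernel_def by (simp only: powr_minus divide_inverse)
qed

lemma V_eq_shifted_gamma:
  assumes "p > 0" "m \<noteq> -1"
  shows "V p m x = shifted_gamma (1 / p - 1) m (x powr p) / Gamma (m + 1)"
proof -
  have "V_integrand p m x = shifted_kernel (1 / p - 1) m (x powr p)"
    using V_integrand_eq_shifted_kernel[OF assms(1)] by blast
  then show ?thesis using assms(2) by (simp add: V_def shifted_gamma_def)
qed

text \<open>
  Exponents below those of the form \<open>1 / p - 1 > -1\<close> arise because differentiation lowers \<open>q\<close> by
  one, hence the statement for all real \<open>q\<close>. Positive exponents
  are of the form \<open>1 / p - 1\<close> and hence covered by the integrability of \<open>V_integrand\<close>; for the
  others the shifted power is at most \<open>X powr q\<close>.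
\<close>

lemma shifted_kernel_integrable:
  assumes "m > -1" "X > 0"
  shows "set_integrable lborel {0<..} (shifted_kernel q m X)"
proof (cases "q > 0")
  case True
  define p where "p = 1 / (q + 1)"
  have p: "p > 0" "1 / p - 1 = q" using True by (auto simp: p_def)
  define x where "x = X powr (1 / p)"
  have x: "x > 0" "x powr p = X" using p(1) assms by (auto simp: x_def powr_powr)
  have "V_integrand p m x = shifted_kernel q m X"
    using V_integrand_eq_shifted_kernel[OF p(1)] p(2) x(2) by auto
  then show ?thesis using V_integrand_integrable[OF p(1) assms(1) x(1)] by simp
next
  case False
  have "set_integrable lborel {0<..} (\<lambda>u. (u powr m * exp (- u)) * X powr q)"
    using Gamma_half_line_integral(1)[OF assms(1)] by (rule set_integrable_mult_left)
  then show ?thesis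
  proof (rule set_integrable_bound)
    show "AE u in lborel. u \<in> {0<..} \<longrightarrow>
        norm (shifted_kernel q m X u) \<le> norm (u powr m * exp (- u) * X powr q)"
    proof (intro AE_I2 impI)
      fix u :: real assume "u \<in> {0<..}"
      then have "(X + u) powr q \<le> X powr q"
        using False assms by (intro powr_mono2') auto
      then have "u powr m * exp (- u) * (X + u) powr q \<le> u powr m * exp (- u) * X powr q"
        by (intro mult_left_mono) auto
      then show "norm (shifted_kernel q m X u) \<le> norm (u powr m * exp (- u) * X powr q)"
        by (simp add: shifted_kernel_def)
    qed
  qed (simp add: set_borel_measurable_def)
qed

text \<open>
  A bound that is uniform in \<open>y\<close> and spares distinguishing whether the power increases or decreases.
\<close>

lemma powr_le_sum_of_endpoint_powrs:
  fixes a b y s :: real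
  assumes "0 < a" "a \<le> y" "y \<le> b"
  shows "y powr s \<le> a powr s + b powr s"
proof (cases "s \<ge> 0")
  case True
  then have "y powr s \<le> b powr s" using assms by (intro powr_mono2) auto
  then show ?thesis by (smt (verit) powr_ge_zero)
next
  case False
  then have "y powr s \<le> a powr s" using assms by (intro powr_mono2') auto
  then show ?thesis by (smt (verit) powr_ge_zero)
qed

text \<open>
  On the neighbourhood \<open>{X / 2<..<2 * X}\<close> of \<open>X\<close> the differentiated kernel is dominated by the sum
  of its absolute values at the two endpoints.
\<close>

lemma shifted_gamma_has_derivative:
  assumes m: "m > -1" and X: "X > 0"
  shows "(shifted_gamma q m has_real_derivative q * shifted_gamma (q - 1) m X) (at X)"
proof -
  let ?I = "indicator {0<..} :: real \<Rightarrow> real"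
  let ?f = "\<lambda>Y u. ?I u * shifted_kernel q m Y u"
  let ?f' = "\<lambda>Y u. ?I u * (q * shifted_kernel (q - 1) m Y u)"
  let ?w = "\<lambda>u. ?I u * (\<bar>q\<bar> * (shifted_kernel (q - 1) m (X / 2) u + shifted_kernel (q - 1) m (2 * X) u))"
  have "((\<lambda>Y. \<integral>u. ?f Y u \<partial>lborel) has_real_derivative (\<integral>u. ?f' X u \<partial>lborel)) (at X)"
  proof (rule has_real_derivative_lebesgue_integral[where S = "{X / 2<..<2 * X}" and w = ?w and f' = ?f'])
    show "integrable lborel (?f Y)" if "Y \<in> {X / 2<..<2 * X}" for Y
      using shifted_kernel_integrable[of m Y q] that m X by (simp add: set_integrable_def)
    show "((\<lambda>Y. ?f Y u) has_real_derivative ?f' Y u) (at Y)"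
      if "Y \<in> {X / 2<..<2 * X}" for Y u
      using that X by (cases "u > 0") (auto simp: shifted_kernel_def intro!: derivative_eq_intros)
    show "\<bar>?f' Y u\<bar> \<le> ?w u" if "Y \<in> {X / 2<..<2 * X}" for Y u
    proof (cases "u > 0")
      case True
      have "(Y + u) powr (q - 1) \<le> (X / 2 + u) powr (q - 1) + (2 * X + u) powr (q - 1)"
        using that True X by (intro powr_le_sum_of_endpoint_powrs) auto
      then have "u powr m * exp (- u) * (Y + u) powr (q - 1)
          \<le> u powr m * exp (- u) * ((X / 2 + u) powr (q - 1) + (2 * X + u) powr (q - 1))"
        by (intro mult_left_mono) auto
      then have "\<bar>q\<bar> * shifted_kernel (q - 1) m Y u
          \<le> \<bar>q\<bar> * (shifted_kernel (q - 1) m (X / 2) u + shifted_kernel (q - 1) m (2 * X) u)"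
        by (intro mult_left_mono) (auto simp: shifted_kernel_def algebra_simps)
      moreover have "shifted_kernel (q - 1) m Y u \<ge> 0"
        by (simp add: shifted_kernel_def)
      ultimately show ?thesis using True by (simp add: abs_mult)
    qed simp
    have "set_integrable lborel {0<..} (\<lambda>u. \<bar>q\<bar> * (shifted_kernel (q - 1) m (X / 2) u + shifted_kernel (q - 1) m (2 * X) u))"
      using m X by (intro set_integrable_mult_right set_integral_add shifted_kernel_integrable) auto
    then show "integrable lborel ?w" by (simp add: set_integrable_def)
  qed (use X in auto)
  moreover have "(\<integral>u. ?f' X u \<partial>lborel) = q * shifted_gamma (q - 1) m X"
    by (simp add: shifted_gamma_def set_lebesgue_integral_def mult.left_commute)
  moreover have "(\<lambda>Y. \<integral>u. ?f Y u \<partial>lborel) = shifted_gamma q m"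
    by (auto simp: shifted_gamma_def set_lebesgue_integral_def)
  ultimately show ?thesis by simp
qed

text \<open>
  The next two limits are the boundary terms of the integration by parts.
\<close>

lemma shifted_kernel_at_right_0:
  assumes m: "m \<ge> 0" and X: "X > 0"
  shows "(shifted_kernel q m X \<longlongrightarrow> (if m = 0 then X powr q else 0)) (at_right 0)"
proof (cases "m = 0")
  case True
  have "((\<lambda>u. exp (- u) * (X + u) powr q) \<longlongrightarrow> exp (- 0) * (X + 0) powr q) (at_right 0)"
    using X by (intro tendsto_intros) auto
  moreover have "\<forall>\<^sub>F u in at_right 0. exp (- u) * (X + u) powr q = shifted_kernel q m X u"
    using eventually_at_right_less[of "0::real"]
    by eventually_elim (simp add: True shifted_kernel_def)
  ultimately show ?thesis
    using True by (auto elim: Lim_transform_eventually)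
next
  case False
  with m have "m > 0" by simp
  have "((\<lambda>u. u powr m * exp (- u) * (X + u) powr q) \<longlongrightarrow>
      0 powr m * exp (- 0) * (X + 0) powr q) (at_right 0)"
    using X \<open>m > 0\<close> eventually_at_right_less[of "0::real"]
    by (intro tendsto_intros tendsto_powr') (auto elim: eventually_mono)
  then show ?thesis
    using False by (simp add: shifted_kernel_def[abs_def])
qed

lemma shifted_kernel_at_top:
  assumes X: "X > 0"
  shows "(shifted_kernel q m X \<longlongrightarrow> 0) at_top"
proof (rule Lim_null_comparison)
  show "\<forall>\<^sub>F u in at_top. norm (shifted_kernel q m X u) \<le> (1 + 2 powr q) * (u powr (m + q) * exp (- u))"
    using eventually_ge_at_top[of X]
  proof eventually_elim
    case (elim u)
    \<comment> \<open>For \<open>u \<ge> X\<close> the base \<open>X + u\<close> lies between \<open>u\<close> and \<open>2 * u\<close>.\<close>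
    have "(X + u) powr q \<le> u powr q + (2 * u) powr q"
      using elim X by (intro powr_le_sum_of_endpoint_powrs) auto
    also have "\<dots> = (1 + 2 powr q) * u powr q"
      by (simp add: powr_mult distrib_right)
    finally have "u powr m * exp (- u) * (X + u) powr q
        \<le> u powr m * exp (- u) * ((1 + 2 powr q) * u powr q)"
      by (intro mult_left_mono) auto
    also have "\<dots> = (1 + 2 powr q) * (u powr (m + q) * exp (- u))"
      by (simp add: powr_add)
    finally show ?case
      by (simp add: shifted_kernel_def)
  qed
  have "((\<lambda>u::real. u powr (m + q) * exp (- u)) \<longlongrightarrow> 0) at_top"
    by real_asymp
  then show "((\<lambda>u. (1 + 2 powr q) * (u powr (m + q) * exp (- u))) \<longlongrightarrow> 0) at_top"
    by (rule tendsto_mult_right_zero)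
qed

text \<open>
  Integrate the \<open>u\<close>-derivative of \<open>u powr m * exp (- u) * (X + u) powr q\<close> over the half-line. Only
  for \<open>m = 0\<close> does this product have a nonzero limit at \<open>0\<close>; in that case the integral
  \<open>shifted_gamma q (m - 1) X\<close> would diverge, and the boundary value takes its place.
\<close>

lemma shifted_gamma_by_parts:
  assumes m: "m \<ge> 0" and X: "X > 0"
  shows "q * shifted_gamma (q - 1) m X =
    shifted_gamma q m X - (if m = 0 then X powr q else m * shifted_gamma q (m - 1) X)"
proof -
  let ?k = "shifted_kernel"
  let ?f = "\<lambda>u. m * ?k q (m - 1) X u - ?k q m X u + q * ?k (q - 1) m X u"
  have int_m: "set_integrable lborel {0<..} (\<lambda>u. m * ?k q (m - 1) X u)"
  \<comment> \<open>For \<open>m = 0\<close> the kernel with exponent \<open>m - 1 = -1\<close> is not integrable at \<open>0\<close>, but the factor \<open>m\<close> removes it.\<close>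
  proof (cases "m = 0")
    case False
    then show ?thesis
      using shifted_kernel_integrable[of "m - 1" X q] m X by simp
  qed (simp add: set_integrable_def)
  have int_q: "set_integrable lborel {0<..} (?k q m X)"
    and int_q1: "set_integrable lborel {0<..} (\<lambda>u. q * ?k (q - 1) m X u)"
    using shifted_kernel_integrable[of m X] m X by simp_all
  have int: "set_integrable lborel {0<..} ?f"
    by (rule set_integral_add(1)[OF set_integral_diff(1)[OF int_m int_q] int_q1])
  have "(LBINT u=0..\<infinity>. ?f u) = 0 - (if m = 0 then X powr q else 0)"
  proof (rule interval_integral_FTC_integrable[where F = "?k q m X"])
    fix u assume "0 < ereal u"
    then have u: "u > 0" by simp
    have "((\<lambda>u. u powr m * exp (- u) * (X + u) powr q) has_real_derivative
        (m * u powr (m - 1) * exp (- u) - u powr m * exp (- u)) * (X + u) powr q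
        + u powr m * exp (- u) * (q * (X + u) powr (q - 1))) (at u)"
      using u X by (auto intro!: derivative_eq_intros)
    moreover have "(m * u powr (m - 1) * exp (- u) - u powr m * exp (- u)) * (X + u) powr q
        + u powr m * exp (- u) * (q * (X + u) powr (q - 1)) = ?f u"
      by (simp add: shifted_kernel_def left_diff_distrib)
    ultimately show "(?k q m X has_vector_derivative ?f u) (at u)"
      unfolding has_real_derivative_iff_has_vector_derivative[symmetric] shifted_kernel_def
      by simp
    show "isCont ?f u"
      using u X unfolding shifted_kernel_def by (intro continuous_intros) auto
  next
    show "set_integrable lborel (einterval 0 \<infinity>) ?f"
      using int by (simp add: zero_ereal_def)
    show "((?k q m X \<circ> real_of_ereal) \<longlongrightarrow> (if m = 0 then X powr q else 0)) (at_right 0)"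
      using shifted_kernel_at_right_0[OF m X] by (simp add: zero_ereal_def ereal_tendsto_simps)
    show "((?k q m X \<circ> real_of_ereal) \<longlongrightarrow> 0) (at_left \<infinity>)"
      using shifted_kernel_at_top[OF X] by (simp add: ereal_tendsto_simps)
  qed simp
  then have "(LBINT u:{0<..}. ?f u) = - (if m = 0 then X powr q else 0)"
    by (simp add: zero_ereal_def interval_integral_to_infinity_eq)
  also have "(LBINT u:{0<..}. ?f u) =
      m * shifted_gamma q (m - 1) X - shifted_gamma q m X + q * shifted_gamma (q - 1) m X"
    using set_integral_add(2)[OF set_integral_diff(1)[OF int_m int_q] int_q1]
      set_integral_diff(2)[OF int_m int_q]
    by (simp add: shifted_gamma_def)
  finally show ?thesis by (auto split: if_splits)
qed

section \<open>The functions \<open>V\<close>\<close>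

lemma V_at_0:
  assumes p: "p > 0" and m: "m > -1" "m > - (1 / p)"
  shows "set_integrable lborel {0<..} (V_integrand p m 0)"
    and "V p m 0 = Gamma (m + 1 / p) / Gamma (m + 1)"
proof -
  define s where "s = m + 1 / p - 1"
  have s: "s > -1" using m by (simp add: s_def)
  have eq: "V_integrand p m 0 u = u powr s * exp (- u)" if "u \<in> {0<..}" for u
    using that p by (simp add: V_integrand_eq_shifted_kernel shifted_kernel_def s_def powr_add[symmetric] algebra_simps)
  show "set_integrable lborel {0<..} (V_integrand p m 0)"
    using Gamma_half_line_integral(1)[OF s] eq
    by (subst set_integrable_cong[OF refl refl]) auto
  have "(LBINT u:{0<..}. V_integrand p m 0 u) = (LBINT u:{0<..}. u powr s * exp (- u))"
    using eq by (intro set_lebesgue_integral_cong) auto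
  then show "V p m 0 = Gamma (m + 1 / p) / Gamma (m + 1)"
    using m Gamma_half_line_integral(2)[OF s] by (simp add: V_def s_def)
qed

lemma V_has_derivative:
  assumes p: "p > 0" and m: "m \<ge> 0" and x: "x > 0"
  shows "(V p m has_real_derivative p * x powr (p - 1) * (V p m x - V p (m - 1) x)) (at x)"
proof -
  define q where "q = 1 / p - 1"
  define X where "X = x powr p"
  have X: "X > 0" using x by (simp add: X_def)
  have V_fun: "V p m = (\<lambda>x. shifted_gamma q m (x powr p) / Gamma (m + 1))"
    using V_eq_shifted_gamma[OF p] m by (auto simp: q_def)
  have V_at_x: "V p m x = shifted_gamma q m X / Gamma (m + 1)"
    using V_fun by (simp add: X_def)
  have "((\<lambda>x. x powr p) has_real_derivative p * x powr (p - 1)) (at x)"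
    using x by (auto intro!: derivative_eq_intros)
  moreover have "(shifted_gamma q m has_real_derivative q * shifted_gamma (q - 1) m X) (at (x powr p))"
    using shifted_gamma_has_derivative[of m X q] m X by (simp add: X_def)
  ultimately have "((\<lambda>x. shifted_gamma q m (x powr p)) has_real_derivative
      q * shifted_gamma (q - 1) m X * (p * x powr (p - 1))) (at x)"
    by (rule DERIV_chain2[rotated])
  then have "(V p m has_real_derivative
      q * shifted_gamma (q - 1) m X * (p * x powr (p - 1)) / Gamma (m + 1)) (at x)"
    unfolding V_fun by (rule DERIV_cdivide)
  moreover have diff: "q * shifted_gamma (q - 1) m X / Gamma (m + 1) = V p m x - V p (m - 1) x"
  proof (cases "m = 0")
    case True
    have "X powr q = x powr (1 - p)"
      using p by (simp add: X_def q_def powr_powr right_diff_distrib)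
    then have "V p (m - 1) x = X powr q" using True by (simp add: V_def)
    then show ?thesis
      using shifted_gamma_by_parts[OF m X, of q] True V_at_x by simp
  next
    case False
    have "Gamma (m + 1) = m * Gamma m"
      using False m by (intro Gamma_plus1) (auto dest: nonpos_Ints_nonpos)
    then have "m * shifted_gamma q (m - 1) X / Gamma (m + 1) = V p (m - 1) x"
      using False m V_eq_shifted_gamma[OF p, of "m - 1" x] by (simp add: X_def q_def)
    then show ?thesis
      using shifted_gamma_by_parts[OF m X, of q] False
      by (simp add: V_at_x diff_divide_distrib)
  qed
  ultimately show ?thesis
    unfolding diff[symmetric] by (simp add: mult_ac)
qed

lemma V_strict_monotone:
  assumes p: "p > 0" and m: "m > -1"
  shows "p > 1 \<Longrightarrow> strict_antimono_on {0<..} (V p m)"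
    and "p < 1 \<Longrightarrow> strict_mono_on {0<..} (V p m)"
proof -
  define q where "q = 1 / p - 1"
  have G: "Gamma (m + 1) > 0" using m by simp
  have V: "V p m x = shifted_gamma q m (x powr p) / Gamma (m + 1)" for x
    using V_eq_shifted_gamma[OF p] m by (simp add: q_def)
  have int: "set_integrable lborel {0<..} (shifted_kernel q m (x powr p))" if "x > 0" for x
    using shifted_kernel_integrable[OF m] that by simp
  show "strict_antimono_on {0<..} (V p m)" if "p > 1"
  proof (rule monotone_onI)
    fix x y :: real assume xy: "x \<in> {0<..}" "y \<in> {0<..}" "x < y"
    have "q < 0" using that by (simp add: q_def)
    then have "shifted_kernel q m (y powr p) u < shifted_kernel q m (x powr p) u" if "u > 0" for u
      unfolding shifted_kernel_def using that xy p
      by (intro mult_strict_left_mono powr_less_mono2_neg) (auto intro!: powr_less_mono2 add_pos_pos)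
    then have "shifted_gamma q m (y powr p) < shifted_gamma q m (x powr p)"
      unfolding shifted_gamma_def using xy by (intro half_line_integral_strict_mono int) auto
    then show "V p m x > V p m y" unfolding V using G by (simp add: divide_strict_right_mono)
  qed
  show "strict_mono_on {0<..} (V p m)" if "p < 1"
  proof (rule monotone_onI)
    fix x y :: real assume xy: "x \<in> {0<..}" "y \<in> {0<..}" "x < y"
    have "q > 0" using that p by (simp add: q_def)
    then have "shifted_kernel q m (x powr p) u < shifted_kernel q m (y powr p) u" if "u > 0" for u
      unfolding shifted_kernel_def using that xy p
      by (intro mult_strict_left_mono powr_less_mono2) (auto intro!: powr_less_mono2)
    then have "shifted_gamma q m (x powr p) < shifted_gamma q m (y powr p)"
      unfolding shifted_gamma_def using xy by (intro half_line_integral_strict_mono int) auto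
    then show "V p m x < V p m y" unfolding V using G by (simp add: divide_strict_right_mono)
  qed
qed

lemma V_1_eq_1:
  assumes m: "m > -1" and x: "x > 0"
  shows "V 1 m x = 1"
proof -
  have "shifted_gamma 0 m x = (LBINT u:{0<..}. u powr m * exp (- u))"
    unfolding shifted_gamma_def using x
    by (intro set_lebesgue_integral_cong) (auto simp: shifted_kernel_def)
  then have "shifted_gamma 0 m x = Gamma (m + 1)"
    using Gamma_half_line_integral(2)[OF m] by simp
  moreover have "Gamma (m + 1) \<noteq> 0" using m by (intro less_imp_neq[symmetric]) simp
  ultimately show ?thesis using V_eq_shifted_gamma[of 1 m x] m x by simp
qed

text \<open>
  Since \<open>a powr (p - 1) = (a powr p) powr (- (1 / p - 1))\<close>, the prefactor cancels the power of
  \<open>a powr p\<close> that can be taken out of the shifted power. Afterwards \<open>a\<close> occurs only once, so that the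
  monotonicity in \<open>a\<close> is visible.
\<close>

lemma scaled_shifted_kernel:
  assumes p: "p > 0" and a: "a > 0" and x: "x > 0" and u: "u > 0"
  shows "a powr (p - 1) * shifted_kernel (1 / p - 1) m ((a * x) powr p) u
       = u powr m * exp (- u) * (x powr p + u / a powr p) powr (1 / p - 1)"
proof -
  define A where "A = a powr p"
  have A: "A > 0" using a by (simp add: A_def)
  have "a powr (p - 1) = A powr (- (1 / p - 1))"
    using p by (simp add: A_def powr_powr right_diff_distrib)
  moreover have "(a * x) powr p + u = A * (x powr p + u / A)"
    using a x A by (simp add: A_def powr_mult distrib_left)
  moreover have "(A * (x powr p + u / A)) powr (1 / p - 1)
      = A powr (1 / p - 1) * (x powr p + u / A) powr (1 / p - 1)"
    by (rule powr_mult)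
  moreover have "A powr (- (1 / p - 1)) * A powr (1 / p - 1) = 1"
    using A by (simp flip: powr_add)
  ultimately show ?thesis
    unfolding shifted_kernel_def A_def[symmetric] by simp
qed

lemma V_scaled_strict_monotone:
  assumes p: "p > 0" and m: "m > -1" and x: "x > 0"
  shows "p > 1 \<Longrightarrow> strict_mono_on {0<..} (\<lambda>a. a powr (p - 1) * V p m (a * x))"
    and "p < 1 \<Longrightarrow> strict_antimono_on {0<..} (\<lambda>a. a powr (p - 1) * V p m (a * x))"
proof -
  define q where "q = 1 / p - 1"
  let ?g = "\<lambda>a u. a powr (p - 1) * shifted_kernel q m ((a * x) powr p) u"
  have G: "Gamma (m + 1) > 0" using m by simp
  have V: "a powr (p - 1) * V p m (a * x) = (LBINT u:{0<..}. ?g a u) / Gamma (m + 1)" for a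
    using V_eq_shifted_gamma[OF p] m by (simp add: q_def shifted_gamma_def)
  have int: "set_integrable lborel {0<..} (?g a)" if "a > 0" for a
    using shifted_kernel_integrable[OF m] that x by (intro set_integrable_mult_right) simp
  have g: "?g a u = u powr m * exp (- u) * (x powr p + u / a powr p) powr q" if "a > 0" "u > 0" for a u
    unfolding q_def using scaled_shifted_kernel[OF p that(1) x that(2)] .
  have base: "x powr p + u / b powr p < x powr p + u / a powr p" "0 < x powr p + u / b powr p"
    if "0 < a" "a < b" "u > 0" for a b u
  proof -
    have "a powr p < b powr p" using that p by (intro powr_less_mono2) auto
    then show "x powr p + u / b powr p < x powr p + u / a powr p"
      using that by (auto intro!: divide_strict_left_mono)
    show "0 < x powr p + u / b powr p" using that x by (intro add_pos_nonneg) auto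
  qed
  show "strict_mono_on {0<..} (\<lambda>a. a powr (p - 1) * V p m (a * x))" if "p > 1"
  proof (rule monotone_onI)
    fix a b :: real assume ab: "a \<in> {0<..}" "b \<in> {0<..}" "a < b"
    have q: "q < 0" using that by (simp add: q_def)
    have "?g a u < ?g b u" if "u > 0" for u
      using g[of a u] g[of b u] base[of a b u] ab that q
      by (auto intro!: mult_strict_left_mono powr_less_mono2_neg)
    then have "(LBINT u:{0<..}. ?g a u) < (LBINT u:{0<..}. ?g b u)"
      using ab by (intro half_line_integral_strict_mono int) auto
    then show "a powr (p - 1) * V p m (a * x) < b powr (p - 1) * V p m (b * x)"
      unfolding V using G by (rule divide_strict_right_mono)
  qed
  show "strict_antimono_on {0<..} (\<lambda>a. a powr (p - 1) * V p m (a * x))" if "p < 1"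
  proof (rule monotone_onI)
    fix a b :: real assume ab: "a \<in> {0<..}" "b \<in> {0<..}" "a < b"
    have q: "q > 0" using that p by (simp add: q_def)
    have "?g b u < ?g a u" if "u > 0" for u
      using g[of a u] g[of b u] base[of a b u] ab that q
      by (auto intro!: mult_strict_left_mono powr_less_mono2)
    then have "(LBINT u:{0<..}. ?g b u) < (LBINT u:{0<..}. ?g a u)"
      using ab by (intro half_line_integral_strict_mono int) auto
    then show "a powr (p - 1) * V p m (a * x) > b powr (p - 1) * V p m (b * x)"
      unfolding V using G by (rule divide_strict_right_mono)
  qed
qed

theorem proposition5:
  fixes p :: real
  assumes "p > 0"
  shows
    "(\<forall>m::real. m > -1 \<and> m > - (1 / p) \<longrightarrow>
        set_integrable lborel {0<..} (V_integrand p m 0) \<and>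
        V p m 0 = Gamma (m + 1 / p) / Gamma (m + 1)) \<and>
     (\<forall>m\<ge>0. \<forall>x>0.
        ((\<lambda>x. V p m x) has_real_derivative
           p * x powr (p - 1) * (V p m x - V p (m - 1) x)) (at x)) \<and>
     (\<forall>m>-1.
        (p > 1 \<longrightarrow> strict_antimono_on {0<..} (\<lambda>x. V p m x)) \<and>
        (p = 1 \<longrightarrow> (\<forall>x>0. V p m x = 1)) \<and>
        (p < 1 \<longrightarrow> strict_mono_on {0<..} (\<lambda>x. V p m x))) \<and>
     (\<forall>m>-1. \<forall>x>0.
        (p > 1 \<longrightarrow> strict_mono_on {0<..} (\<lambda>a. a powr (p - 1) * V p m (a * x))) \<and>
        (p < 1 \<longrightarrow> strict_antimono_on {0<..} (\<lambda>a. a powr (p - 1) * V p m (a * x))))"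
proof (intro conjI allI impI)
  fix m :: real assume "m > -1 \<and> m > - (1 / p)"
  then show "set_integrable lborel {0<..} (V_integrand p m 0)"
    and "V p m 0 = Gamma (m + 1 / p) / Gamma (m + 1)"
    using V_at_0[OF assms, of m] by auto
next
  fix m x :: real assume "m \<ge> 0" "x > 0"
  then show "(V p m has_real_derivative p * x powr (p - 1) * (V p m x - V p (m - 1) x)) (at x)"
    by (rule V_has_derivative[OF assms])
next
  fix m :: real assume m: "m > -1"
  show "strict_antimono_on {0<..} (V p m)" if "p > 1"
    using V_strict_monotone(1)[OF assms m that] .
  show "V p m x = 1" if "p = 1" "x > 0" for x
    using V_1_eq_1[OF m that(2)] that(1) by simp
  show "strict_mono_on {0<..} (V p m)" if "p < 1"
    using V_strict_monotone(2)[OF assms m that] .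
next
  fix m x :: real assume mx: "m > -1" "x > 0"
  show "strict_mono_on {0<..} (\<lambda>a. a powr (p - 1) * V p m (a * x))" if "p > 1"
    using V_scaled_strict_monotone(1)[OF assms mx that] .
  show "strict_antimono_on {0<..} (\<lambda>a. a powr (p - 1) * V p m (a * x))" if "p < 1"
    using V_scaled_strict_monotone(2)[OF assms mx that] .
qed

end
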